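(* Let $D$ be a distributive lattice with unit and let $P$ be a $D$-comeasured partial lattice. Each of the following conditions implies that $P$ is finitely covering and that (the $D$-valued partial lattice associated with) $P$ satisfies $(\mathrm{Id}\cap)$, $(\mathrm{Id}\vee)$, $(\mathrm{Fil}\cap)$, and $(\mathrm{Fil}\vee)$: 1. $P$ is finite and both $\mathrm{dom}\bigvee$ and $\mathrm{dom}\bigwedge$ are nonempty. 2. $P$ is a lattice (that is, $\mathrm{dom}\bigvee=\mathrm{dom}\bigwedge$ is the set of all nonempty finite subsets of $P$).
   Context: **Partial lattices.** $[X]^{<\omega}_*$ is the set of nonempty finite subsets of $X$. A *partial lattice* is $\langle P,\le,\bigvee,\bigwedge\rangle$ with $\langle P,\le\rangle$ a nonempty poset and $\bigvee,\bigwedge$ partial functions from $[P]^{<\omega}_*$ to $P$ such that $a=\bigvee X$ implies $a=\sup X$ and $a=\bigwedge X$ implies $a=\inf X$; $\mathrm{dom}$ denotes the domain of a partial function. **Comeasured partial lattices.** Let $D$ be a distributive lattice with unit $1$. A *$D$-comeasured partial lattice* is a partial lattice $P$ with a map $P\times P\to D$, $\langle x,y\rangle\mapsto\|x\le y\|$, such that: $\|x\le y\|=1$ if $x\le y$; $\|x\le y\|\wedge\|y\le z\|\le\|x\le z\|$; $a=\bigvee X$ implies $\|a\le b\|=\bigwedge_{x\in X}\|x\le b\|$ for all $b$; and $a=\bigwedge X$ implies $\|b\le a\|=\bigwedge_{x\in X}\|b\le x\|$ for all $b$. **Finiteness conditions.** Put $\|a=b\|=\|a\le b\|\wedge\|b\le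 a\|$; for $X,Y\in[P]^{<\omega}_*$ put $\|X\subseteq Y\|=\bigwedge_{x\in X}\bigvee_{y\in Y}\|x=y\|$ and $\|X=Y\|=\|X\subseteq Y\|\wedge\|Y\subseteq X\|$. For $\mathcal D\subseteq[P]^{<\omega}_*$, a *$\mathcal D$-cover* of $X\in[P]^{<\omega}_*$ is a nonempty finite $\mathcal D'\subseteq\mathcal D$ such that $\|X=Y\|\le\bigvee_{Z\in\mathcal D'}\|X=Z\|$ for all $Y\in\mathcal D$. $P$ is *finitely covering* if every $X\in[P]^{<\omega}_*$ has a $\mathrm{dom}\bigvee$-cover and a $\mathrm{dom}\bigwedge$-cover. In that case the associated $D$-valued partial lattice is given by $\|a=\bigvee X\|=\bigvee_{i<n}\|a=a_i\|\wedge\|X=X_i\|$, where $\{X_i\mid i<n\}$ is any $\mathrm{dom}\bigvee$-cover of $X$ and $a_i=\bigvee X_i$ (the value does not depend on the cover), and dually for $\|a=\bigwedge X\|$ using $\mathrm{dom}\bigwedge$-covers. A *join-sample* of $X$ is a nonempty finite $U\subseteq P$ with $\|x=\bigvee X\|\le\bigvee_{u\in U}\|u=\bigvee X\|$ for all $x\in P$; meet-samples are defined dually (these exist when $P$ is finitely covering). Put $\|a\le\bigvee X\|=\bigvee_{u\in U}\|a\le u\|\wedge\|u=\bigvee X\|$ for any join-sample $U$ of $X$, and $\|\bigwedge X\le a\|=\bigvee_{u\in U}\|u\le a\|\wedge\|u=\bigwedge X\|$ for any meet-sample $U$ of $X$ (independent of $U$). For $X,U\in[P]^{<\omega}_*$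 put $\|a\in\mathrm{Id}_0(X,U)\|=\bigvee_{x\in X}\|a\le x\|$ and $$\|a\in\mathrm{Id}_{n+1}(X,U)\|=\|a\in\mathrm{Id}_n(X,U)\|\vee\bigvee_{\varnothing\ne Z\subseteq U}\Bigl(\|a\le\textstyle\bigvee Z\|\wedge\bigwedge_{z\in Z}\|z\in\mathrm{Id}_n(X,U)\|\Bigr);$$ $\|a\in\mathrm{Fil}_n(X,U)\|$ is defined dually, starting with $\bigvee_{x\in X}\|x\le a\|$ and using $\|\bigwedge Z\le a\|$. A finitely covering $P$ has: - $(\mathrm{Id}\cap)$ if for all $a,b\in P$ there is $U\in[P]^{<\omega}_*$ with $\|x\le a\|\wedge\|x\le b\|=\bigvee_{u\in U}\|x\le u\|\wedge\|u\le a\|\wedge\|u\le b\|$ for all $x\in P$; - $(\mathrm{Fil}\cap)$ if the dual holds: for all $a,b$ there is $U$ with $\|a\le x\|\wedge\|b\le x\|=\bigvee_{u\in U}\|u\le x\|\wedge\|a\le u\|\wedge\|b\le u\|$ for all $x$; - $(\mathrm{Id}\vee)$ if for every $X\in[P]^{<\omega}_*$ there are $U\in[P]^{<\omega}_*$ and $n<\omega$ with $\|a\in\mathrm{Id}_n(X,U)\|=\|a\in\mathrm{Id}_{n+1}(X,Y)\|$ for all $a\in P$ and all finite $Y\supseteq U$; - $(\mathrm{Fil}\vee)$ if the same holds with $\mathrm{Fil}$ in place of $\mathrm{Id}$. *)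

theory Defs
  imports "HOL-Library.Lub_Glb"
begin

definition nefin :: "'p set set"
  where "nefin = {X. finite X \<and> X \<noteq> {}}"

text \<open>
  The poset is the universe of a type \<open>'p\<close> of class \<open>order\<close> (types are nonempty). The value
  \<open>J X = Some a\<close> renders \<open>a = \<Or>X\<close>, and \<open>M X = Some a\<close> renders \<open>a = \<And>X\<close>.
\<close>

locale partial_lattice =
  fixes J M :: "'p::order set \<rightharpoonup> 'p"
  assumes dom_J: "dom J \<subseteq> nefin"
    and dom_M: "dom M \<subseteq> nefin"
    and J_isLub: "J X = Some a \<Longrightarrow> isLub UNIV X a"
    and M_isGlb: "M X = Some a \<Longrightarrow> isGlb UNIV X a"

text \<open>
  The distributive lattice \<open>D\<close> is the universe of a type \<open>'d\<close>. It need not have a least element,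
  so all finite joins and meets in \<open>D\<close> are \<^const>\<open>Sup_fin\<close> and \<^const>\<open>Inf_fin\<close>, taken over
  nonempty finite sets only. The value \<open>e x y\<close> renders \<open>\<parallel>x \<le> y\<parallel>\<close>.
\<close>

locale comeasured_partial_lattice = partial_lattice J M
  for J M :: "'p::order set \<rightharpoonup> 'p" +
  fixes e :: "'p \<Rightarrow> 'p \<Rightarrow> 'd::{distrib_lattice,order_top}"
  assumes e_le: "x \<le> y \<Longrightarrow> e x y = top"
    and e_trans: "inf (e x y) (e y z) \<le> e x z"
    and e_J: "J X = Some a \<Longrightarrow> e a b = Inf_fin ((\<lambda>x. e x b) ` X)"
    and e_M: "M X = Some a \<Longrightarrow> e b a = Inf_fin ((\<lambda>x. e b x) ` X)"

context
  fixes e :: "'p \<Rightarrow> 'p \<Rightarrow> 'd::{distrib_lattice,order_top}"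
begin

definition eq_val :: "'p \<Rightarrow> 'p \<Rightarrow> 'd"
  where "eq_val a b = inf (e a b) (e b a)"

definition subset_val :: "'p set \<Rightarrow> 'p set \<Rightarrow> 'd"
  where "subset_val X Y = Inf_fin ((\<lambda>x. Sup_fin ((\<lambda>y. eq_val x y) ` Y)) ` X)"

definition set_eq_val :: "'p set \<Rightarrow> 'p set \<Rightarrow> 'd"
  where "set_eq_val X Y = inf (subset_val X Y) (subset_val Y X)"

definition is_cover :: "'p set set \<Rightarrow> 'p set \<Rightarrow> 'p set set \<Rightarrow> bool"
  where "is_cover \<D> X C \<longleftrightarrow>
    finite C \<and> C \<noteq> {} \<and> C \<subseteq> \<D> \<and>
    (\<forall>Y\<in>\<D>. set_eq_val X Y \<le> Sup_fin ((\<lambda>Z. set_eq_val X Z) ` C))"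

definition finitely_covering :: "('p set \<rightharpoonup> 'p) \<Rightarrow> ('p set \<rightharpoonup> 'p) \<Rightarrow> bool"
  where "finitely_covering J M \<longleftrightarrow>
    (\<forall>X\<in>nefin. (\<exists>C. is_cover (dom J) X C) \<and> (\<exists>C. is_cover (dom M) X C))"

text \<open>
  The expression giving \<open>\<parallel>a = \<Or>X\<parallel>\<close> (for \<open>F = J\<close>) and \<open>\<parallel>a = \<And>X\<parallel>\<close> (for \<open>F = M\<close>) from a given
  cover \<open>C\<close> of \<open>X\<close>, and the value itself, computed from a chosen cover; the choice is irrelevant
  by the lemmas \<open>J_op_val_cover\<close> and \<open>M_op_val_cover\<close> below.
\<close>

definition op_val_of_cover :: "('p set \<rightharpoonup> 'p) \<Rightarrow> 'p set set \<Rightarrow> 'p \<Rightarrow> 'p set \<Rightarrow> 'd"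
  where "op_val_of_cover F C a X =
    Sup_fin ((\<lambda>Z. inf (eq_val a (the (F Z))) (set_eq_val X Z)) ` C)"

definition op_val :: "('p set \<rightharpoonup> 'p) \<Rightarrow> 'p \<Rightarrow> 'p set \<Rightarrow> 'd"
  where "op_val F a X = op_val_of_cover F (SOME C. is_cover (dom F) X C) a X"

text \<open>Join-samples are the case \<open>F = J\<close>, meet-samples the case \<open>F = M\<close>.\<close>

definition is_sample :: "('p set \<rightharpoonup> 'p) \<Rightarrow> 'p set \<Rightarrow> 'p set \<Rightarrow> bool"
  where "is_sample F X U \<longleftrightarrow>
    finite U \<and> U \<noteq> {} \<and> (\<forall>x. op_val F x X \<le> Sup_fin ((\<lambda>u. op_val F u X) ` U))"

text \<open>
  \<open>\<parallel>a \<le> \<Or>X\<parallel>\<close> and \<open>\<parallel>\<And>X \<le> a\<parallel>\<close>, computed from a chosen sample; samples exist and the choice is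
  irrelevant by the lemmas \<open>ex_J_sample\<close>, \<open>le_join_val_sample\<close> and their duals below.
\<close>

definition le_join_val :: "('p set \<rightharpoonup> 'p) \<Rightarrow> 'p \<Rightarrow> 'p set \<Rightarrow> 'd"
  where "le_join_val J a X =
    Sup_fin ((\<lambda>u. inf (e a u) (op_val J u X)) ` (SOME U. is_sample J X U))"

definition meet_le_val :: "('p set \<rightharpoonup> 'p) \<Rightarrow> 'p set \<Rightarrow> 'p \<Rightarrow> 'd"
  where "meet_le_val M X a =
    Sup_fin ((\<lambda>u. inf (e u a) (op_val M u X)) ` (SOME U. is_sample M X U))"

primrec Id_val :: "('p set \<rightharpoonup> 'p) \<Rightarrow> nat \<Rightarrow> 'p set \<Rightarrow> 'p set \<Rightarrow> 'p \<Rightarrow> 'd"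
  where
    "Id_val J 0 X U a = Sup_fin ((\<lambda>x. e a x) ` X)"
  | "Id_val J (Suc n) X U a =
      sup (Id_val J n X U a)
        (Sup_fin ((\<lambda>Z. inf (le_join_val J a Z) (Inf_fin ((\<lambda>z. Id_val J n X U z) ` Z)))
          ` {Z. Z \<noteq> {} \<and> Z \<subseteq> U}))"

primrec Fil_val :: "('p set \<rightharpoonup> 'p) \<Rightarrow> nat \<Rightarrow> 'p set \<Rightarrow> 'p set \<Rightarrow> 'p \<Rightarrow> 'd"
  where
    "Fil_val M 0 X U a = Sup_fin ((\<lambda>x. e x a) ` X)"
  | "Fil_val M (Suc n) X U a =
      sup (Fil_val M n X U a)
        (Sup_fin ((\<lambda>Z. inf (meet_le_val M Z a) (Inf_fin ((\<lambda>z. Fil_val M n X U z) ` Z)))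
          ` {Z. Z \<noteq> {} \<and> Z \<subseteq> U}))"

definition Id_cap :: bool
  where "Id_cap \<longleftrightarrow>
    (\<forall>a b. \<exists>U\<in>nefin. \<forall>x.
      inf (e x a) (e x b) = Sup_fin ((\<lambda>u. inf (e x u) (inf (e u a) (e u b))) ` U))"

definition Fil_cap :: bool
  where "Fil_cap \<longleftrightarrow>
    (\<forall>a b. \<exists>U\<in>nefin. \<forall>x.
      inf (e a x) (e b x) = Sup_fin ((\<lambda>u. inf (e u x) (inf (e a u) (e b u))) ` U))"

definition Id_join :: "('p set \<rightharpoonup> 'p) \<Rightarrow> bool"
  where "Id_join J \<longleftrightarrow>
    (\<forall>X\<in>nefin. \<exists>U\<in>nefin. \<exists>n. \<forall>a Y. finite Y \<and> U \<subseteq> Y \<longrightarrow>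
      Id_val J n X U a = Id_val J (Suc n) X Y a)"

definition Fil_join :: "('p set \<rightharpoonup> 'p) \<Rightarrow> bool"
  where "Fil_join M \<longleftrightarrow>
    (\<forall>X\<in>nefin. \<exists>U\<in>nefin. \<exists>n. \<forall>a Y. finite Y \<and> U \<subseteq> Y \<longrightarrow>
      Fil_val M n X U a = Fil_val M (Suc n) X Y a)"

end

text \<open>The values above do not depend on the chosen covers and samples.\<close>

lemma le_Sup_fin_image:
  fixes f :: "'a \<Rightarrow> 'b::lattice"
  assumes "finite A" "x \<in> A" "c \<le> f x"
  shows "c \<le> Sup_fin (f ` A)"
  using assms by (auto intro: order_trans[OF _ Sup_fin.coboundedI])

lemma Sup_fin_image_le:
  fixes f :: "'a \<Rightarrow> 'b::lattice"
  assumes "finite A" "A \<noteq> {}" "\<And>x. x \<in> A \<Longrightarrow> f x \<le> c"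
  shows "Sup_fin (f ` A) \<le> c"
  using assms by (auto intro!: Sup_fin.boundedI)

lemma Inf_fin_image_le:
  fixes f :: "'a \<Rightarrow> 'b::lattice"
  assumes "finite A" "x \<in> A" "f x \<le> c"
  shows "Inf_fin (f ` A) \<le> c"
  using assms by (auto intro: order_trans[OF Inf_fin.coboundedI])

lemma le_Inf_fin_image:
  fixes f :: "'a \<Rightarrow> 'b::lattice"
  assumes "finite A" "A \<noteq> {}" "\<And>x. x \<in> A \<Longrightarrow> c \<le> f x"
  shows "c \<le> Inf_fin (f ` A)"
  using assms by (auto intro!: Inf_fin.boundedI)

lemma le_of_le_Sup_fin_image:
  fixes f :: "'a \<Rightarrow> 'b::distrib_lattice"
  assumes "finite A" "A \<noteq> {}" "b \<le> Sup_fin (f ` A)" "\<And>x. x \<in> A \<Longrightarrow> inf b (f x) \<le> c"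
  shows "b \<le> c"
proof -
  have "b = inf b (Sup_fin (f ` A))"
    using assms(3) by (simp add: inf_absorb1)
  also have "\<dots> = Sup_fin {inf b y |y. y \<in> f ` A}"
    using assms(1,2) by (intro inf_Sup1_distrib) auto
  also have "{inf b y |y. y \<in> f ` A} = (\<lambda>x. inf b (f x)) ` A"
    by auto
  also have "Sup_fin \<dots> \<le> c"
    using assms by (intro Sup_fin_image_le) auto
  finally show ?thesis .
qed

context comeasured_partial_lattice
begin

lemma eq_val_refl: "eq_val e x x = top"
  by (simp add: eq_val_def e_le)

lemma eq_val_sym: "eq_val e x y = eq_val e y x"
  by (simp add: eq_val_def inf_commute)

lemma e_trans': "c \<le> e x y \<Longrightarrow> c \<le> e y z \<Longrightarrow> c \<le> e x z"
  using e_trans[of x y z] by (auto intro: order_trans[of c "inf (e x y) (e y z)"])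

lemma eq_val_trans': "c \<le> eq_val e x y \<Longrightarrow> c \<le> eq_val e y z \<Longrightarrow> c \<le> eq_val e x z"
  using e_trans'[of c x y z] e_trans'[of c z y x] by (simp add: eq_val_def)

lemma set_eq_val_sym: "set_eq_val e X Y = set_eq_val e Y X"
  by (simp add: set_eq_val_def inf_commute)

lemma le_subset_valD:
  assumes "X \<in> nefin" "c \<le> subset_val e X Y" "x \<in> X"
  shows "c \<le> Sup_fin (eq_val e x ` Y)"
proof -
  have "subset_val e X Y \<le> Sup_fin (eq_val e x ` Y)"
    unfolding subset_val_def using assms by (intro Inf_fin_image_le[of _ x]) (auto simp: nefin_def)
  with assms(2) show ?thesis by (rule order_trans)
qed

lemma subset_val_trans':
  assumes "X \<in> nefin" "Y \<in> nefin" "Z \<in> nefin" "c \<le> subset_val e X Y" "c \<le> subset_val e Y Z"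
  shows "c \<le> subset_val e X Z"
  unfolding subset_val_def
proof (rule le_Inf_fin_image)
  fix x assume x: "x \<in> X"
  show "c \<le> Sup_fin (eq_val e x ` Z)"
  proof (rule le_of_le_Sup_fin_image[OF _ _ le_subset_valD[OF assms(1,4) x]])
    fix y assume y: "y \<in> Y"
    show "inf c (eq_val e x y) \<le> Sup_fin (eq_val e x ` Z)"
    proof (rule le_of_le_Sup_fin_image[of Z])
      show "inf c (eq_val e x y) \<le> Sup_fin (eq_val e y ` Z)"
        using le_subset_valD[OF assms(2,5) y] by (rule le_infI1)
      fix z assume "z \<in> Z"
      then show "inf (inf c (eq_val e x y)) (eq_val e y z) \<le> Sup_fin (eq_val e x ` Z)"
        using assms(3) by (intro le_Sup_fin_image[of _ z] eq_val_trans'[of _ x y z])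
          (auto simp: nefin_def intro: le_infI1)
    qed (use assms in \<open>auto simp: nefin_def\<close>)
  qed (use assms in \<open>auto simp: nefin_def\<close>)
qed (use assms in \<open>auto simp: nefin_def\<close>)

lemma set_eq_val_trans':
  assumes "X \<in> nefin" "Y \<in> nefin" "Z \<in> nefin" "c \<le> set_eq_val e X Y" "c \<le> set_eq_val e Y Z"
  shows "c \<le> set_eq_val e X Z"
  using assms subset_val_trans'[of X Y Z c] subset_val_trans'[of Z Y X c]
  by (simp add: set_eq_val_def)

text \<open>Both \<open>J\<close> and \<open>M\<close> respect the \<open>D\<close>-valued equality.\<close>

definition congruent_op :: "('p set \<rightharpoonup> 'p) \<Rightarrow> bool"
  where "congruent_op F \<longleftrightarrow> dom F \<subseteq> nefin \<and>
    (\<forall>X\<in>dom F. \<forall>Y\<in>dom F. set_eq_val e X Y \<le> eq_val e (the (F X)) (the (F Y)))"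

lemma J_le:
  assumes "J X = Some a" "J Y = Some b"
  shows "subset_val e X Y \<le> e a b"
proof -
  have X: "X \<in> nefin" and Y: "Y \<in> nefin"
    using assms dom_J by auto
  show ?thesis unfolding e_J[OF assms(1)]
  proof (rule le_Inf_fin_image)
    fix x assume x: "x \<in> X"
    show "subset_val e X Y \<le> e x b"
    proof (rule le_of_le_Sup_fin_image[OF _ _ le_subset_valD[OF X order_refl x]])
      fix y assume "y \<in> Y"
      then have "e y b = top"
        using J_isLub[OF assms(2)] by (intro e_le) (rule isLubD2)
      moreover have "inf (subset_val e X Y) (eq_val e x y) \<le> e x y"
        by (simp add: eq_val_def le_infI1 le_infI2)
      ultimately show "inf (subset_val e X Y) (eq_val e x y) \<le> e x b"
        by (intro e_trans'[of _ x y b]) auto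
    qed (use Y in \<open>auto simp: nefin_def\<close>)
  qed (use X in \<open>auto simp: nefin_def\<close>)
qed

lemma M_le:
  assumes "M X = Some a" "M Y = Some b"
  shows "subset_val e X Y \<le> e b a"
proof -
  have X: "X \<in> nefin" and Y: "Y \<in> nefin"
    using assms dom_M by auto
  show ?thesis unfolding e_M[OF assms(1)]
  proof (rule le_Inf_fin_image)
    fix x assume x: "x \<in> X"
    show "subset_val e X Y \<le> e b x"
    proof (rule le_of_le_Sup_fin_image[OF _ _ le_subset_valD[OF X order_refl x]])
      fix y assume "y \<in> Y"
      then have "e b y = top"
        using M_isGlb[OF assms(2)] by (intro e_le) (rule isGlbD2)
      moreover have "inf (subset_val e X Y) (eq_val e x y) \<le> e y x"
        by (simp add: eq_val_def le_infI1 le_infI2)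
      ultimately show "inf (subset_val e X Y) (eq_val e x y) \<le> e b x"
        by (intro e_trans'[of _ b y x]) auto
    qed (use Y in \<open>auto simp: nefin_def\<close>)
  qed (use X in \<open>auto simp: nefin_def\<close>)
qed

lemma congruent_op_J: "congruent_op J"
  unfolding congruent_op_def set_eq_val_def eq_val_def
  using dom_J by (auto intro: le_infI1[OF J_le] le_infI2[OF J_le])

lemma congruent_op_M: "congruent_op M"
  unfolding congruent_op_def set_eq_val_def eq_val_def
  using dom_M by (auto intro: le_infI1[OF M_le] le_infI2[OF M_le])

lemma op_val_of_cover_le:
  assumes F: "congruent_op F" and X: "X \<in> nefin"
    and C: "is_cover e (dom F) X C" and C': "is_cover e (dom F) X C'"
  shows "op_val_of_cover e F C a X \<le> op_val_of_cover e F C' a X"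
  unfolding op_val_of_cover_def[of e F C]
proof (rule Sup_fin_image_le)
  fix Z assume Z: "Z \<in> C"
  let ?c = "inf (eq_val e a (the (F Z))) (set_eq_val e X Z)"
  have Zd: "Z \<in> dom F" using C Z by (auto simp: is_cover_def)
  show "?c \<le> op_val_of_cover e F C' a X"
  proof (rule le_of_le_Sup_fin_image[of C'])
    show "?c \<le> Sup_fin (set_eq_val e X ` C')"
      using C' Zd unfolding is_cover_def by (blast intro: le_infI2)
    fix W assume W: "W \<in> C'"
    let ?d = "inf ?c (set_eq_val e X W)"
    have Wd: "W \<in> dom F" using C' W by (auto simp: is_cover_def)
    have "?d \<le> set_eq_val e Z X" "?d \<le> set_eq_val e X W"
      by (auto simp: set_eq_val_sym[of Z X] intro: le_infI1 le_infI2)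
    moreover have "Z \<in> nefin" "W \<in> nefin"
      using F Zd Wd unfolding congruent_op_def by blast+
    ultimately have "?d \<le> set_eq_val e Z W"
      using X by (intro set_eq_val_trans'[of Z X W])
    also have "\<dots> \<le> eq_val e (the (F Z)) (the (F W))"
      using F Zd Wd unfolding congruent_op_def by blast+
    finally have "?d \<le> eq_val e a (the (F W))"
      by (intro eq_val_trans'[of _ a "the (F Z)" "the (F W)"]) (auto intro: le_infI1)
    then show "?d \<le> op_val_of_cover e F C' a X"
      unfolding op_val_of_cover_def using C' W
      by (intro le_Sup_fin_image[of _ W]) (auto simp: is_cover_def)
  qed (use C' in \<open>auto simp: is_cover_def\<close>)
qed (use C in \<open>auto simp: is_cover_def\<close>)

lemma op_val_cover:
  assumes "congruent_op F" "X \<in> nefin" "is_cover e (dom F) X C"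
  shows "op_val e F a X = op_val_of_cover e F C a X"
  unfolding op_val_def using assms someI[of "is_cover e (dom F) X", OF assms(3)]
  by (intro antisym op_val_of_cover_le)

lemmas J_op_val_cover = op_val_cover[OF congruent_op_J]
lemmas M_op_val_cover = op_val_cover[OF congruent_op_M]

lemma op_val_eq:
  assumes F: "congruent_op F" and X: "X \<in> nefin" and C: "is_cover e (dom F) X C"
    and c: "c \<le> op_val e F a X" "c \<le> op_val e F b X"
  shows "c \<le> eq_val e a b"
  using c(1) unfolding op_val_cover[OF F X C] op_val_of_cover_def
proof (rule le_of_le_Sup_fin_image[rotated 2])
  fix Z assume Z: "Z \<in> C"
  let ?c = "inf c (inf (eq_val e a (the (F Z))) (set_eq_val e X Z))"
  have Zd: "Z \<in> dom F" using C Z by (auto simp: is_cover_def)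
  have "?c \<le> op_val e F b X" using c(2) by (rule le_infI1)
  then show "?c \<le> eq_val e a b" unfolding op_val_cover[OF F X C] op_val_of_cover_def
  proof (rule le_of_le_Sup_fin_image[rotated 2])
    fix W assume W: "W \<in> C"
    let ?d = "inf ?c (inf (eq_val e b (the (F W))) (set_eq_val e X W))"
    have Wd: "W \<in> dom F" using C W by (auto simp: is_cover_def)
    have "?d \<le> set_eq_val e Z X" "?d \<le> set_eq_val e X W"
      by (auto simp: set_eq_val_sym[of Z X] intro: le_infI1 le_infI2)
    moreover have "Z \<in> nefin" "W \<in> nefin"
      using F Zd Wd unfolding congruent_op_def by blast+
    ultimately have "?d \<le> set_eq_val e Z W"
      using X by (intro set_eq_val_trans'[of Z X W])
    also have "\<dots> \<le> eq_val e (the (F Z)) (the (F W))"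
      using F Zd Wd unfolding congruent_op_def by blast+
    finally have "?d \<le> eq_val e a (the (F W))"
      by (intro eq_val_trans'[of _ a "the (F Z)" "the (F W)"]) (auto intro: le_infI1 le_infI2)
    moreover have "?d \<le> eq_val e (the (F W)) b"
      by (auto simp: eq_val_sym[of "the (F W)"] intro: le_infI1 le_infI2)
    ultimately show "?d \<le> eq_val e a b"
      by (rule eq_val_trans')
  qed (use C in \<open>auto simp: is_cover_def\<close>)
qed (use C in \<open>auto simp: is_cover_def\<close>)

lemma ex_sample:
  assumes F: "congruent_op F" and X: "X \<in> nefin" and C: "is_cover e (dom F) X C"
  shows "is_sample e F X ((\<lambda>Z. the (F Z)) ` C)"
  unfolding is_sample_def
proof (intro conjI allI)
  fix x
  show "op_val e F x X \<le> Sup_fin ((\<lambda>u. op_val e F u X) ` (\<lambda>Z. the (F Z)) ` C)"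
    unfolding op_val_cover[OF F X C, of x] op_val_of_cover_def[of _ _ _ x] image_image
  proof (rule Sup_fin_image_le)
    fix Z assume Z: "Z \<in> C"
    have "set_eq_val e X Z \<le> op_val e F (the (F Z)) X"
      unfolding op_val_cover[OF F X C] op_val_of_cover_def using C Z
      by (intro le_Sup_fin_image[of _ Z]) (auto simp: is_cover_def eq_val_refl)
    then show "inf (eq_val e x (the (F Z))) (set_eq_val e X Z)
        \<le> Sup_fin ((\<lambda>Z. op_val e F (the (F Z)) X) ` C)"
      using C Z by (intro le_Sup_fin_image[of _ Z]) (auto simp: is_cover_def intro: le_infI2)
  qed (use C in \<open>auto simp: is_cover_def\<close>)
qed (use C in \<open>auto simp: is_cover_def\<close>)

lemmas ex_J_sample = ex_sample[OF congruent_op_J]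
lemmas ex_M_sample = ex_sample[OF congruent_op_M]

lemma sample_le:
  assumes F: "congruent_op F" and X: "X \<in> nefin" and C: "is_cover e (dom F) X C"
    and U: "is_sample e F X U" and V: "is_sample e F X V"
    and g: "\<And>u v. inf (g u) (eq_val e u v) \<le> g v"
  shows "Sup_fin ((\<lambda>u. inf (g u) (op_val e F u X)) ` U)
    \<le> Sup_fin ((\<lambda>u. inf (g u) (op_val e F u X)) ` V)"
proof (rule Sup_fin_image_le)
  fix u assume u: "u \<in> U"
  let ?c = "inf (g u) (op_val e F u X)"
  show "?c \<le> Sup_fin ((\<lambda>u. inf (g u) (op_val e F u X)) ` V)"
  proof (rule le_of_le_Sup_fin_image[of V])
    show "?c \<le> Sup_fin ((\<lambda>v. op_val e F v X) ` V)"
      using V by (auto simp: is_sample_def intro: le_infI2)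
    fix v assume v: "v \<in> V"
    let ?d = "inf ?c (op_val e F v X)"
    have "?d \<le> eq_val e u v"
      by (rule op_val_eq[OF F X C]) (auto intro: le_infI1 le_infI2)
    then have "?d \<le> inf (g u) (eq_val e u v)"
      by (auto intro: le_infI1)
    then have "?d \<le> g v" using g by (rule order_trans)
    then show "?d \<le> Sup_fin ((\<lambda>u. inf (g u) (op_val e F u X)) ` V)"
      using V v by (intro le_Sup_fin_image[of _ v]) (auto simp: is_sample_def)
  qed (use V in \<open>auto simp: is_sample_def\<close>)
qed (use U in \<open>auto simp: is_sample_def\<close>)

lemma le_join_val_sample:
  assumes "X \<in> nefin" "is_cover e (dom J) X C" "is_sample e J X U"
  shows "le_join_val e J a X = Sup_fin ((\<lambda>u. inf (e a u) (op_val e J u X)) ` U)"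
proof -
  have "is_sample e J X (SOME U. is_sample e J X U)"
    using assms(3) by (rule someI)
  moreover have "inf (e a u) (eq_val e u v) \<le> e a v" for u v
    by (rule e_trans'[of _ a u]) (auto simp: eq_val_def intro: le_infI1 le_infI2)
  ultimately show ?thesis
    unfolding le_join_val_def using assms
    by (intro antisym sample_le[OF congruent_op_J, of X C]) auto
qed

lemma meet_le_val_sample:
  assumes "X \<in> nefin" "is_cover e (dom M) X C" "is_sample e M X U"
  shows "meet_le_val e M X a = Sup_fin ((\<lambda>u. inf (e u a) (op_val e M u X)) ` U)"
proof -
  have "is_sample e M X (SOME U. is_sample e M X U)"
    using assms(3) by (rule someI)
  moreover have "inf (e u a) (eq_val e u v) \<le> e v a" for u v
    by (rule e_trans'[of _ v u]) (auto simp: eq_val_def intro: le_infI1 le_infI2)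
  ultimately show ?thesis
    unfolding meet_le_val_def using assms
    by (intro antisym sample_le[OF congruent_op_M, of X C]) auto
qed

end

end

theory Submission
  imports Defs "HOL-Library.FuncSet"
begin

text \<open>
  If \<open>P\<close> is finite, the values \<open>\<parallel>a \<in> Id\<^sub>n(X,P)\<parallel>\<close> lie in a finitely generated sublattice of \<open>D\<close>,
  which is finite because \<open>D\<close> is distributive; being increasing in \<open>n\<close>, they stabilize. If \<open>P\<close> is
  a lattice, then \<open>{X}\<close> is a cover of \<open>X\<close>, hence \<open>\<parallel>a \<le> \<Or>X\<parallel>\<close> is the value at \<open>\<langle>a, \<Or>X\<rangle>\<close> of the
  comeasure, and so is \<open>\<parallel>a \<in> Id\<^sub>n(X,Y)\<parallel>\<close> for all \<open>n \<ge> 1\<close> and \<open>Y \<supseteq> X\<close>. The statements about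
  filters are those about ideals for the map \<open>\<langle>x, y\<rangle> \<mapsto> \<parallel>y \<le> x\<parallel>\<close>.
\<close>

section \<open>Duality between filters and ideals\<close>

lemma Fil_cap_eq_Id_cap: "Fil_cap e \<longleftrightarrow> Id_cap (\<lambda>x y. e y x)"
  by (simp add: Fil_cap_def Id_cap_def)

text \<open>Reversing the comeasure swaps the two factors of \<open>eq_val\<close>, so covers and
  operation values, which depend on the comeasure only through \<open>eq_val\<close>, stay the
  same.\<close>

lemma op_val_converse: "op_val (\<lambda>x y. e y x) F = op_val e F"
proof -
  have eq: "eq_val (\<lambda>x y. e y x) = eq_val e"
    by (intro ext) (simp add: eq_val_def inf_commute)
  have set_eq: "set_eq_val (\<lambda>x y. e y x) = set_eq_val e"
    by (intro ext) (simp add: set_eq_val_def subset_val_def eq)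
  have "is_cover (\<lambda>x y. e y x) = is_cover e"
    by (intro ext) (simp add: is_cover_def set_eq)
  then show ?thesis
    by (intro ext) (simp add: op_val_def op_val_of_cover_def eq set_eq)
qed

lemma meet_le_val_eq_le_join_val:
  "meet_le_val e M X a = le_join_val (\<lambda>x y. e y x) M a X"
  by (simp only: meet_le_val_def le_join_val_def is_sample_def op_val_converse[of e])

text \<open>This is why the results on ideals below live outside the locale: they are applied both
  to \<open>e\<close> with \<open>J\<close> and to the converse of \<open>e\<close> with
  \<open>M\<close>.\<close>

lemma Fil_val_eq_Id_val: "Fil_val e M n X U = Id_val (\<lambda>x y. e y x) M n X U"
  by (induction n) (simp_all add: fun_eq_iff meet_le_val_eq_le_join_val[of e])

lemma Fil_join_eq_Id_join: "Fil_join e M \<longleftrightarrow> Id_join (\<lambda>x y. e y x) M"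
  by (simp add: Fil_join_def Id_join_def Fil_val_eq_Id_val[of e])

section \<open>Finite sublattices of a distributive lattice\<close>

lemma Sup_fin_closed:
  fixes A :: "'d::lattice set"
  assumes "finite A" "A \<noteq> {}" "A \<subseteq> T" "\<And>x y. x \<in> T \<Longrightarrow> y \<in> T \<Longrightarrow> sup x y \<in> T"
  shows "Sup_fin A \<in> T"
  using assms(1-3) by (induction A rule: finite_ne_induct) (auto intro: assms(4))

lemma Inf_fin_closed:
  fixes A :: "'d::lattice set"
  assumes "finite A" "A \<noteq> {}" "A \<subseteq> T" "\<And>x y. x \<in> T \<Longrightarrow> y \<in> T \<Longrightarrow> inf x y \<in> T"
  shows "Inf_fin A \<in> T"
  using assms(1-3) by (induction A rule: finite_ne_induct) (auto intro: assms(4))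

text \<open>Disjunctive normal form: \<open>T\<close> consists of the joins of meets of generators,
  and distributivity keeps it closed under \<open>inf\<close>. Only nonempty joins and meets are
  formed, since \<open>D\<close> may lack a least element.\<close>

lemma finite_sublattice_extension:
  fixes G :: "'d::distrib_lattice set"
  assumes "finite G"
  obtains T where "finite T" "G \<subseteq> T" "\<And>x y. x \<in> T \<Longrightarrow> y \<in> T \<Longrightarrow> sup x y \<in> T"
    "\<And>x y. x \<in> T \<Longrightarrow> y \<in> T \<Longrightarrow> inf x y \<in> T"
proof -
  define N where "N = Inf_fin ` (Pow G - {{}})"
  define T where "T = Sup_fin ` (Pow N - {{}})"
  have finN: "finite N" unfolding N_def using assms by simp
  have infN: "inf x y \<in> N" if xy: "x \<in> N" "y \<in> N" for x y
  proof -
    obtain A B where AB: "A \<subseteq> G" "A \<noteq> {}" "x = Inf_fin A" "B \<subseteq> G" "B \<noteq> {}" "y = Inf_fin B"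
      using xy by (auto simp: N_def)
    have "finite A" "finite B" using AB assms by (auto intro: finite_subset)
    then have "inf x y = Inf_fin (A \<union> B)" using AB by (simp add: Inf_fin.union)
    then show ?thesis using AB by (auto simp: N_def)
  qed
  show thesis
  proof
    show "finite T" unfolding T_def using finN by simp
    show "G \<subseteq> T"
    proof
      fix g assume g: "g \<in> G"
      have "Inf_fin {g} \<in> N" unfolding N_def by (intro imageI) (use g in auto)
      then have "Sup_fin {g} \<in> T" unfolding T_def by (intro imageI) auto
      then show "g \<in> T" by simp
    qed
    fix x y assume "x \<in> T" "y \<in> T"
    then obtain A B where AB: "A \<subseteq> N" "A \<noteq> {}" "x = Sup_fin A" "B \<subseteq> N" "B \<noteq> {}" "y = Sup_fin B"
      by (auto simp: T_def)
    have fin: "finite A" "finite B" using AB finN by (auto intro: finite_subset)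
    have "sup x y = Sup_fin (A \<union> B)" using AB fin by (simp add: Sup_fin.union)
    then show "sup x y \<in> T" using AB by (auto simp: T_def)
    have "inf x y = Sup_fin {inf a b |a b. a \<in> A \<and> b \<in> B}"
      using AB fin by (simp add: inf_Sup2_distrib)
    moreover have "{inf a b |a b. a \<in> A \<and> b \<in> B} \<in> Pow N - {{}}"
      using AB infN by blast
    ultimately show "inf x y \<in> T" by (auto simp: T_def)
  qed
qed

section \<open>Finite \<open>P\<close>\<close>

lemma Id_join_finite:
  fixes e :: "'p \<Rightarrow> 'p \<Rightarrow> 'd::{distrib_lattice,order_top}"
  assumes fin: "finite (UNIV :: 'p set)"
  shows "Id_join e J"
  unfolding Id_join_def
proof
  fix X :: "'p set" assume "X \<in> nefin"
  then have X: "finite X" "X \<noteq> {}" by (auto simp: nefin_def)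
  have finite_set: "finite A" for A :: "'p set"
    using fin by (rule rev_finite_subset) simp
  let ?I = "\<lambda>n. Id_val e J n X UNIV"
  \<comment> \<open>All values that enter the recursion for \<open>Id_val\<close>. The empty
    \<open>Z\<close> is included only for uniformity: its value is unspecified, but
    \<open>?G\<close> remains finite.\<close>
  let ?G = "(\<lambda>(a, b). e a b) ` (UNIV \<times> UNIV) \<union> (\<lambda>(a, Z). le_join_val e J a Z) ` (UNIV \<times> Pow UNIV)"
  have "finite ?G" by (intro finite_UnI finite_imageI finite_cartesian_product) (use fin in \<open>simp_all flip: Pow_UNIV\<close>)
  then obtain T where T: "finite T" "?G \<subseteq> T"
    and sup: "\<And>x y. x \<in> T \<Longrightarrow> y \<in> T \<Longrightarrow> sup x y \<in> T"
    and inf: "\<And>x y. x \<in> T \<Longrightarrow> y \<in> T \<Longrightarrow> inf x y \<in> T"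
    by (rule finite_sublattice_extension) blast
  have eT: "e a b \<in> T" and jT: "le_join_val e J a Z \<in> T" for a b Z
    using T(2) by auto
  have IT: "?I n a \<in> T" for n a
  proof (induction n arbitrary: a)
    case 0
    show ?case using X eT by (auto intro!: Sup_fin_closed sup)
  next
    case (Suc n)
    have "inf (le_join_val e J a Z) (Inf_fin (?I n ` Z)) \<in> T" if "Z \<noteq> {}" for Z
      using that by (intro inf jT Inf_fin_closed) (auto simp: finite_set Suc)
    then show ?case
      using fin by (auto intro!: Sup_fin_closed sup Suc
          finite_subset[of "{Z. Z \<noteq> {}}" "Pow UNIV"])
  qed
  \<comment> \<open>Arguing with whole functions gives one \<open>n\<close> for all
    \<open>a\<close>: a strictly increasing sequence would embed the naturals into the finite set of
    functions from \<open>UNIV\<close> to \<open>T\<close>.\<close>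
  have "\<exists>n. ?I n = ?I (Suc n)"
  proof (rule ccontr)
    assume neq: "\<nexists>n. ?I n = ?I (Suc n)"
    have "?I n \<le> ?I (Suc n)" for n by (rule le_funI) simp
    with neq have "?I n < ?I (Suc n)" for n by (metis le_neq_trans)
    then have "inj ?I"
      by (intro strict_mono_imp_inj_on) (simp add: strict_mono_Suc_iff del: Id_val.simps)
    moreover have "finite (UNIV \<rightarrow>\<^sub>E T :: ('p \<Rightarrow> 'd) set)"
      using fin T(1) by (intro finite_PiE) auto
    then have "finite (range ?I)" by (rule rev_finite_subset) (use IT in auto)
    ultimately show False by (metis finite_imageD infinite_UNIV_nat)
  qed
  then obtain n where n: "?I n = ?I (Suc n)" ..
  \<comment> \<open>With \<open>UNIV\<close> as the witness \<open>U\<close>, the only admissible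
    \<open>Y\<close> is \<open>UNIV\<close> itself.\<close>
  have "Id_val e J n X UNIV a = Id_val e J (Suc n) X Y a" if "UNIV \<subseteq> Y" for a Y
    using that fun_cong[OF n, of a] by (simp only: top_unique)
  moreover have "(UNIV :: 'p set) \<in> nefin" using fin by (simp add: nefin_def)
  ultimately show "\<exists>U\<in>nefin. \<exists>n. \<forall>a Y. finite Y \<and> U \<subseteq> Y \<longrightarrow>
      Id_val e J n X U a = Id_val e J (Suc n) X Y a"
    by blast
qed

text \<open>All of \<open>P\<close> serves as \<open>U\<close>: the term \<open>u = x\<close>
  attains the left-hand side, and by transitivity no term exceeds it.\<close>

lemma Id_cap_finite:
  assumes fin: "finite (UNIV :: 'p set)"
    and refl: "\<And>x. e x x = top"
    and trans: "\<And>x y z. inf (e x y) (e y z) \<le> e (x :: 'p) z"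
  shows "Id_cap e"
  unfolding Id_cap_def
proof (intro allI bexI)
  show "(UNIV :: 'p set) \<in> nefin" using fin by (simp add: nefin_def)
  fix a b x :: 'p
  have "inf (e x u) (inf (e u a) (e u b)) \<le> inf (e x a) (e x b)" for u
    using trans[of x u a] trans[of x u b]
    by (meson inf.boundedI inf.cobounded1 inf.cobounded2 inf.coboundedI2 order_trans)
  then show "inf (e x a) (e x b) = Sup_fin ((\<lambda>u. inf (e x u) (inf (e u a) (e u b))) ` UNIV)"
    using fin by (intro antisym le_Sup_fin_image[of _ x] Sup_fin_image_le) (auto simp: refl)
qed

section \<open>Total operations\<close>

lemma Id_cap_of_meets:
  assumes refl: "\<And>x. e x x = top"
    and meet: "\<And>a b. \<exists>m. \<forall>x. e x m = inf (e x a) (e x b)"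
  shows "Id_cap e"
  unfolding Id_cap_def
proof (intro allI)
  fix a b
  obtain m where m: "\<And>x. e x m = inf (e x a) (e x b)" using meet by blast
  \<comment> \<open>Evaluating the property of \<open>m\<close> at \<open>m\<close> itself shows
    that \<open>m\<close> lies below \<open>a\<close> and \<open>b\<close> with value
    \<open>top\<close>, so \<open>{m}\<close> can serve as \<open>U\<close>.\<close>
  have "top \<le> e m a" "top \<le> e m b"
    using m[of m] by (metis refl inf.cobounded1, metis refl inf.cobounded2)
  then have "e m a = top" "e m b = top" by (simp_all add: top_unique)
  then show "\<exists>U\<in>nefin. \<forall>x. inf (e x a) (e x b)
      = Sup_fin ((\<lambda>u. inf (e x u) (inf (e u a) (e u b))) ` U)"
    by (intro bexI[of _ "{m}"]) (simp_all add: nefin_def m inf_absorb1)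
qed

text \<open>The ideal generated by \<open>X\<close> is the principal ideal of its join and is
  reached after one step, so \<open>U = X\<close> and \<open>n = 1\<close> work.\<close>

lemma Id_join_total:
  fixes e :: "'p \<Rightarrow> 'p \<Rightarrow> 'd::{distrib_lattice,order_top}"
  assumes refl: "\<And>x. e x x = top"
    and trans: "\<And>x y z. inf (e x y) (e y z) \<le> e x z"
    and join: "\<And>X b. X \<in> nefin \<Longrightarrow> e (the (J X)) b = Inf_fin ((\<lambda>x. e x b) ` X)"
    and le_join: "\<And>X a. X \<in> nefin \<Longrightarrow> le_join_val e J a X = e a (the (J X))"
  shows "Id_join e J"
  unfolding Id_join_def
proof
  fix X :: "'p set" assume X: "X \<in> nefin"
  then have finX: "finite X" "X \<noteq> {}" by (auto simp: nefin_def)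
  let ?s = "the (J X)"
  have le_s: "e x ?s = top" if "x \<in> X" for x
  proof -
    have "top \<le> Inf_fin ((\<lambda>x. e x ?s) ` X)" using join[OF X, of ?s] by (simp add: refl)
    also have "\<dots> \<le> e x ?s" using that finX by (intro Inf_fin_image_le[of _ x]) auto
    finally show ?thesis by (simp add: top_unique)
  qed
  have upper: "Id_val e J n X Y a \<le> e a ?s" if Y: "finite Y" "Y \<noteq> {}" for n Y a
  proof (induction n arbitrary: a)
    case 0
    have "e a x \<le> e a ?s" if "x \<in> X" for x
      using trans[of a x ?s] le_s[OF that] by (simp add: inf_absorb1)
    then show ?case using finX by (auto intro!: Sup_fin_image_le)
  next
    case (Suc n)
    have "inf (le_join_val e J a Z) (Inf_fin (Id_val e J n X Y ` Z)) \<le> e a ?s"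
      if Z: "Z \<noteq> {}" "Z \<subseteq> Y" for Z
    proof -
      have finZ: "finite Z" using Z Y by (auto intro: finite_subset)
      then have Z': "Z \<in> nefin" using Z by (simp add: nefin_def)
      \<comment> \<open>By induction each element of \<open>Z\<close> lies below \<open>?s\<close>
        at least to the extent of its ideal value; \<open>join\<close> transfers the meet of these
        bounds to the join of \<open>Z\<close>.\<close>
      have "Inf_fin (Id_val e J n X Y ` Z) \<le> e (the (J Z)) ?s"
        unfolding join[OF Z']
        using Z finZ Suc by (intro le_Inf_fin_image Inf_fin_image_le) auto
      then have "inf (le_join_val e J a Z) (Inf_fin (Id_val e J n X Y ` Z))
          \<le> inf (e a (the (J Z))) (e (the (J Z)) ?s)"
        unfolding le_join[OF Z'] by (rule inf_mono[OF order_refl])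
      then show ?thesis using trans by (rule order_trans)
    qed
    then have "Sup_fin ((\<lambda>Z. inf (le_join_val e J a Z) (Inf_fin (Id_val e J n X Y ` Z)))
        ` {Z. Z \<noteq> {} \<and> Z \<subseteq> Y}) \<le> e a ?s"
      using Y by (intro Sup_fin_image_le) auto
    then show ?case using Suc by simp
  qed
  have zero: "Id_val e J 0 X Y x = top" if "x \<in> X" for x Y
  proof -
    have "top \<le> Id_val e J 0 X Y x"
      using that finX unfolding Id_val.simps
      by (intro le_Sup_fin_image[of _ x]) (auto simp: refl)
    then show ?thesis by (simp add: top_unique)
  qed
  have top: "Id_val e J n X Y x = top" if "x \<in> X" for n x Y
    by (induction n) (use zero[OF that] in \<open>simp_all add: sup_absorb1\<close>)
  have eq: "Id_val e J (Suc n) X Y a = e a ?s" if Y: "finite Y" "X \<subseteq> Y" for n Y a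
  proof (rule antisym)
    show "Id_val e J (Suc n) X Y a \<le> e a ?s" using Y finX by (intro upper) auto
    \<comment> \<open>The summand for \<open>Z = X\<close> suffices: \<open>X\<close> is contained
      in \<open>Y\<close>, and its elements have ideal value \<open>top\<close> at every
      stage.\<close>
    have "e a ?s \<le> inf (le_join_val e J a X) (Inf_fin (Id_val e J n X Y ` X))"
      unfolding le_join[OF X] using finX
      by (intro le_infI le_Inf_fin_image) (auto simp: top)
    then have "e a ?s \<le> Sup_fin ((\<lambda>Z. inf (le_join_val e J a Z) (Inf_fin (Id_val e J n X Y ` Z)))
        ` {Z. Z \<noteq> {} \<and> Z \<subseteq> Y})"
      using Y finX by (intro le_Sup_fin_image[of _ X]) auto
    then show "e a ?s \<le> Id_val e J (Suc n) X Y a" by (simp add: le_supI2)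
  qed
  show "\<exists>U\<in>nefin. \<exists>n. \<forall>a Y. finite Y \<and> U \<subseteq> Y \<longrightarrow>
      Id_val e J n X U a = Id_val e J (Suc n) X Y a"
    \<comment> \<open>Stage 0 only yields the join of the values \<open>e a x\<close> for
      \<open>x\<close> in \<open>X\<close>, which may lie below \<open>e a ?s\<close>; hence
      \<open>Suc 0\<close>.\<close>
    using X finX by (intro bexI[of _ X] exI[of _ "Suc 0"]) (auto simp add: eq simp del: Id_val.simps)
qed

section \<open>Covers and the two cases\<close>

lemma is_cover_finite:
  assumes "finite \<D>" "\<D> \<noteq> {}"
  shows "is_cover e \<D> X \<D>"
  unfolding is_cover_def using assms by (auto intro!: le_Sup_fin_image[OF _ _ order_refl])

context comeasured_partial_lattice
begin

lemma set_eq_val_refl: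
  assumes "X \<in> nefin"
  shows "set_eq_val e X X = top"
proof -
  have fin: "finite X" "X \<noteq> {}" using assms by (auto simp: nefin_def)
  have "top \<le> Sup_fin (eq_val e x ` X)" if "x \<in> X" for x
    using that fin by (intro le_Sup_fin_image[of _ x]) (auto simp: eq_val_refl)
  then have "top \<le> subset_val e X X"
    unfolding subset_val_def using fin by (intro le_Inf_fin_image)
  then show ?thesis by (simp add: set_eq_val_def top_unique)
qed

lemma is_cover_singleton:
  assumes "X \<in> \<D>" "X \<in> nefin"
  shows "is_cover e \<D> X {X}"
  using assms by (simp add: is_cover_def set_eq_val_refl)

lemma op_val_of_mem_dom:
  assumes "congruent_op F" "X \<in> dom F" "X \<in> nefin"
  shows "op_val e F a X = eq_val e a (the (F X))"
  using op_val_cover[OF assms(1,3) is_cover_singleton[OF assms(2,3)]]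
  by (simp add: op_val_of_cover_def set_eq_val_refl assms inf_absorb1)

text \<open>The cover \<open>{X}\<close> yields the join-sample \<open>{the (J X)}\<close>, whose
  only element has operation value \<open>top\<close>.\<close>

lemma le_join_val_of_mem_dom:
  assumes "X \<in> dom J"
  shows "le_join_val e J a X = e a (the (J X))"
proof -
  have X: "X \<in> nefin" using assms dom_J by blast
  note C = is_cover_singleton[OF assms X]
  show ?thesis
    using le_join_val_sample[OF X C ex_J_sample[OF X C]]
    by (simp add: op_val_of_mem_dom[OF congruent_op_J assms X] eq_val_refl inf_absorb1)
qed

lemma meet_le_val_of_mem_dom:
  assumes "X \<in> dom M"
  shows "meet_le_val e M X a = e (the (M X)) a"
proof -
  have X: "X \<in> nefin" using assms dom_M by blast
  note C = is_cover_singleton[OF assms X]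
  show ?thesis
    using meet_le_val_sample[OF X C ex_M_sample[OF X C]]
    by (simp add: op_val_of_mem_dom[OF congruent_op_M assms X] eq_val_refl inf_absorb1)
qed

lemma finite_conditions:
  assumes fin: "finite (UNIV :: 'p set)" and "dom J \<noteq> {}" "dom M \<noteq> {}"
  shows "finitely_covering e J M \<and> Id_cap e \<and> Id_join e J \<and> Fil_cap e \<and> Fil_join e M"
proof (intro conjI)
  have "finite (UNIV :: 'p set set)" using fin by (simp flip: Pow_UNIV)
  then have "finite (dom J)" "finite (dom M)" by (auto intro: rev_finite_subset)
  \<comment> \<open>Each domain, being finite and nonempty, is a cover of every
    \<open>X\<close>.\<close>
  then show "finitely_covering e J M"
    unfolding finitely_covering_def using assms(2,3) is_cover_finite by metis
  have trans: "inf (e y x) (e z y) \<le> e z x" for x y z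
    using e_trans[of z y x] by (simp add: inf_commute)
  show "Id_cap e" using fin e_le e_trans by (intro Id_cap_finite) auto
  show "Fil_cap e" unfolding Fil_cap_eq_Id_cap
    using fin e_le trans by (intro Id_cap_finite) auto
  show "Id_join e J" using fin by (rule Id_join_finite)
  show "Fil_join e M" unfolding Fil_join_eq_Id_join using fin by (rule Id_join_finite)
qed

lemma lattice_conditions:
  assumes J: "dom J = nefin" and M: "dom M = nefin"
  shows "finitely_covering e J M \<and> Id_cap e \<and> Id_join e J \<and> Fil_cap e \<and> Fil_join e M"
proof (intro conjI)
  show "finitely_covering e J M"
    unfolding finitely_covering_def J M using is_cover_singleton by metis
  have refl: "e x x = top" for x by (simp add: e_le)
  have trans: "inf (e y x) (e z y) \<le> e z x" for x y z
    using e_trans[of z y x] by (simp add: inf_commute)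
  have join: "e (the (J X)) b = Inf_fin ((\<lambda>x. e x b) ` X)" if "X \<in> nefin" for X b
    using that J by (intro e_J) (metis domD option.sel)
  have meet: "e b (the (M X)) = Inf_fin ((\<lambda>x. e b x) ` X)" if "X \<in> nefin" for X b
    using that M by (intro e_M) (metis domD option.sel)
  show "Id_cap e"
  proof (rule Id_cap_of_meets[OF refl])
    fix a b
    show "\<exists>m. \<forall>x. e x m = inf (e x a) (e x b)"
      using meet[of "{a, b}"] by (intro exI[of _ "the (M {a, b})"]) (simp add: nefin_def)
  qed
  show "Fil_cap e"
    unfolding Fil_cap_eq_Id_cap
  proof (rule Id_cap_of_meets[OF refl])
    fix a b
    show "\<exists>m. \<forall>x. e m x = inf (e a x) (e b x)"
      using join[of "{a, b}"] by (intro exI[of _ "the (J {a, b})"]) (simp add: nefin_def)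
  qed
  show "Id_join e J"
    by (rule Id_join_total[OF refl e_trans join]) (simp_all add: J le_join_val_of_mem_dom)
  show "Fil_join e M"
    unfolding Fil_join_eq_Id_join
    \<comment> \<open>For the converse map, \<open>meet\<close> is the join hypothesis of
      \<open>Id_join_total\<close>.\<close>
    by (rule Id_join_total[OF refl trans meet])
      (simp_all add: M meet_le_val_of_mem_dom flip: meet_le_val_eq_le_join_val)
qed

end

theorem proposition12p7:
  fixes J M :: "'p::order set \<rightharpoonup> 'p"
    and e :: "'p \<Rightarrow> 'p \<Rightarrow> 'd::{distrib_lattice,order_top}"
  assumes "comeasured_partial_lattice J M e"
    and "(finite (UNIV :: 'p set) \<and> dom J \<noteq> {} \<and> dom M \<noteq> {}) \<or> (dom J = nefin \<and> dom M = nefin)"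
  shows "finitely_covering e J M \<and> Id_cap e \<and> Id_join e J \<and> Fil_cap e \<and> Fil_join e M"
proof -
  interpret comeasured_partial_lattice J M e by fact
  show ?thesis using assms(2) finite_conditions lattice_conditions by blast
qed

end
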